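(* Let $\mathcal{G}$ be an uncertain graph with terminal set $\mathbb{T}$ and network reliability $R=R[\mathcal{G},\mathbb{T}]$, and suppose there are uncertain graphs $\mathcal{G}_1,\dots,\mathcal{G}_m$ with terminal sets $\mathbb{T}_1,\dots,\mathbb{T}_m$ and a number $p_b$ such that $R=p_b\cdot\prod_{i=1}^m R_i$, where $R_i=R[\mathcal{G}_i,\mathbb{T}_i]$. Let $s$ be a positive integer, let $\hat R_1,\dots,\hat R_m$ be independent estimators where $\hat R_i$ is the Monte Carlo estimator of $R_i$ from $s$ independent samples (so $E[\hat R_i]=R_i$ and $Var[\hat R_i]=R_i(1-R_i)/s$), and let $\hat R=p_b\prod_{i=1}^m\hat R_i$. If $0<R<1$ and $0<p_b<1$, then \[ Var[\hat R] < \frac{R(1-R)}{s}, \] i.e. the variance is smaller than that of the Monte Carlo estimator of $R$ computed directly on $\mathcal{G}$ with $s$ samples.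
   Context: An uncertain graph $\mathcal{G}=(\mathbb{V},\mathbb{E},p)$ is a connected undirected graph in which each edge $e$ has an existence probability $p(e)\in(0,1]$, edges existing independently. The network reliability $R[\mathcal{G},\mathbb{T}]$ for a terminal set $\mathbb{T}$ is the probability that all terminals lie in one connected component of the random graph obtained by keeping each edge independently with its probability. The Monte Carlo estimator of $R[\mathcal{G},\mathbb{T}]$ with $s$ samples is the fraction of $s$ independently sampled possible graphs in which all terminals are connected. *)

theory Defs
  imports "HOL-Probability.Probability"
begin

text \<open>Edges are unordered pairs \<open>{u, v}\<close> of vertices; a loop is the case \<open>u = v\<close>.\<close>

record 'v uncertain_graph =
  verts :: "'v set"
  edges :: "'v set set"
  eprob :: "'v set \<Rightarrow> real"

definition components :: "'v set \<Rightarrow> 'v set set \<Rightarrow> 'v set set" where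
  "components V F = V // {(u, v). u \<in> V \<and> v \<in> V \<and> (u, v) \<in> {(x, y). {x, y} \<in> F}\<^sup>*}"

text \<open>The condition \<open>components V E = {V}\<close> below says that the graph is connected; it
  also forces \<open>V\<close> to be nonempty.\<close>

definition uncertain_graph :: "'v uncertain_graph \<Rightarrow> bool" where
  "uncertain_graph G \<longleftrightarrow>
     finite (verts G) \<and>
     edges G \<subseteq> {{u, v} | u v. u \<in> verts G \<and> v \<in> verts G} \<and>
     components (verts G) (edges G) = {verts G} \<and>
     (\<forall>e\<in>edges G. 0 < eprob G e \<and> eprob G e \<le> 1)"

text \<open>A possible graph always keeps all vertices, so it is represented by its edge set.\<close>

definition possible_graph :: "'v uncertain_graph \<Rightarrow> 'v set set pmf" where
  "possible_graph G =
     map_pmf (\<lambda>f. {e \<in> edges G. f e})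
       (Pi_pmf (edges G) False (\<lambda>e. bernoulli_pmf (eprob G e)))"

definition terminals_connected ::
  "'v uncertain_graph \<Rightarrow> 'v set \<Rightarrow> 'v set set \<Rightarrow> bool" where
  "terminals_connected G T F \<longleftrightarrow> (\<exists>C\<in>components (verts G) F. T \<subseteq> C)"

definition reliability :: "'v uncertain_graph \<Rightarrow> 'v set \<Rightarrow> real" where
  "reliability G T = measure_pmf.prob (possible_graph G) {F. terminals_connected G T F}"

definition mc_samples ::
  "'w measure \<Rightarrow> 'v uncertain_graph \<Rightarrow> nat \<Rightarrow> (nat \<Rightarrow> 'w \<Rightarrow> 'v set set) \<Rightarrow> bool" where
  "mc_samples M G s X \<longleftrightarrow>
     prob_space.indep_vars M (\<lambda>_. count_space UNIV) X {..<s} \<and>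
     (\<forall>j<s. distr M (count_space UNIV) (X j) = measure_pmf (possible_graph G))"

definition mc_estimator ::
  "'v uncertain_graph \<Rightarrow> 'v set \<Rightarrow> nat \<Rightarrow> (nat \<Rightarrow> 'w \<Rightarrow> 'v set set) \<Rightarrow> 'w \<Rightarrow> real" where
  "mc_estimator G T s X \<omega> = real (card {j. j < s \<and> terminals_connected G T (X j \<omega>)}) / real s"

end

theory Submission
  imports Defs
begin

text \<open>Independence gives \<open>E[\<Prod> R\<^sub>i\<^sup>2] = \<Prod> R\<^sub>i (r + (1 - r) R\<^sub>i)\<close> for the estimators, where
  \<open>r = 1 / s\<close>. The affine map \<open>x \<mapsto> r + (1 - r) x\<close> is submultiplicative on \<open>[0, 1]\<close>, so with
  \<open>P = \<Prod> R\<^sub>i\<close> the second moment of the product estimator is at most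
  \<open>p\<^sub>b\<^sup>2 P (r + (1 - r) P) = R (p\<^sub>b r + (1 - r) R)\<close>. Since \<open>p\<^sub>b < 1\<close>, this is strictly below the
  second moment \<open>R (r + (1 - r) R)\<close> of the direct estimator, and both estimators have mean \<open>R\<close>.\<close>

text \<open>For two factors, the image of the product exceeds the product of the images by
  \<open>r * (1 - r) * ((1 - x) * (1 - y))\<close>, which is nonnegative on the unit interval;
  induction extends this to finite products. Over an empty or infinite index set both sides are
  1.\<close>

lemma prod_affine_le:
  fixes r :: real and x :: "'i \<Rightarrow> real"
  assumes "0 \<le> r" "r \<le> 1" and "\<And>i. i \<in> I \<Longrightarrow> 0 \<le> x i \<and> x i \<le> 1"
  shows "(\<Prod>i\<in>I. r + (1 - r) * x i) \<le> r + (1 - r) * (\<Prod>i\<in>I. x i)"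
  using assms(3)
proof (induction I rule: infinite_finite_induct)
  case (insert j I)
  define P where "P = (\<Prod>i\<in>I. x i)"
  have P: "0 \<le> P" "P \<le> 1"
    using insert.prems unfolding P_def by (auto intro: prod_nonneg prod_le_1)
  have xj: "0 \<le> x j" "x j \<le> 1"
    using insert.prems by auto
  have "(\<Prod>i\<in>insert j I. r + (1 - r) * x i) \<le> (r + (1 - r) * x j) * (r + (1 - r) * P)"
    using insert xj assms(1,2) by (auto simp: P_def intro!: mult_left_mono)
  \<comment> \<open>The subtracted term is exactly the defect of multiplicativity of the affine
    map.\<close>
  also have "\<dots> = r + (1 - r) * (x j * P) - r * (1 - r) * ((1 - x j) * (1 - P))"
    by (simp add: algebra_simps)
  also have "\<dots> \<le> r + (1 - r) * (x j * P)"
    using assms(1,2) P xj by simp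
  finally show ?case
    using insert.hyps by (simp add: P_def)
qed auto

context prob_space
begin

text \<open>Expanding the square of the sum leaves \<open>s\<close> diagonal terms with expectation
  \<open>p\<close>, since a 0-1 variable equals its square, and \<open>s * (s - 1)\<close>
  off-diagonal terms with expectation \<open>p\<^sup>2\<close> by independence. The second moment is
  written as \<open>p\<close> times an affine function of \<open>p\<close> so that
  \<open>prod_affine_le\<close> applies to products of such moments.\<close>

lemma bernoulli_mean_moments:
  fixes B :: "nat \<Rightarrow> 'a \<Rightarrow> real"
  assumes indep: "indep_vars (\<lambda>_. borel) B {..<s}"
    and B01: "\<And>j \<omega>. B j \<omega> \<in> {0, 1}"
    and mean: "\<And>j. j < s \<Longrightarrow> expectation (B j) = p"
    and s: "s > 0"
  shows "expectation (\<lambda>\<omega>. (\<Sum>j<s. B j \<omega>) / real s) = p"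
    and "expectation (\<lambda>\<omega>. ((\<Sum>j<s. B j \<omega>) / real s)\<^sup>2) = p * (1 / real s + (1 - 1 / real s) * p)"
proof -
  have rv [measurable]: "random_variable borel (B j)" if "j < s" for j
    using indep that by (auto simp: indep_vars_def)
  have bound: "norm (B j \<omega>) \<le> 1" for j \<omega>
    using B01[of j \<omega>] by auto
  have int: "integrable M (B j)" if "j < s" for j
    using that bound by (intro integrable_const_bound[where B = 1]) auto
  have int2: "integrable M (\<lambda>\<omega>. B j \<omega> * B k \<omega>)" if "j < s" "k < s" for j k
  proof (rule integrable_const_bound[where B = 1])
    show "AE \<omega> in M. norm (B j \<omega> * B k \<omega>) \<le> 1"
      using mult_mono[OF bound bound] by (simp add: abs_mult)
  qed (use that in measurable)
  have cov: "expectation (\<lambda>\<omega>. B j \<omega> * B k \<omega>) = (if j = k then p else p\<^sup>2)"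
    if jk: "j < s" "k < s" for j k
  proof (cases "j = k")
    case True
    have "(\<lambda>\<omega>. B k \<omega> * B k \<omega>) = B k"
    proof
      show "B k \<omega> * B k \<omega> = B k \<omega>" for \<omega>
        using B01[of k \<omega>] by auto
    qed
    then show ?thesis
      using mean jk True by simp
  next
    case False
    \<comment> \<open>The pair is read as a product over a two-element index set, so the
      factorization for independent families applies.\<close>
    have "expectation (\<lambda>\<omega>. \<Prod>i\<in>{j, k}. B i \<omega>) = (\<Prod>i\<in>{j, k}. expectation (B i))"
      using jk int by (intro indep_vars_lebesgue_integral indep_vars_subset[OF indep]) auto
    then show ?thesis
      using False jk mean by (simp add: power2_eq_square)
  qed
  show "expectation (\<lambda>\<omega>. (\<Sum>j<s. B j \<omega>) / real s) = p"
    using s int mean by simp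
  have "expectation (\<lambda>\<omega>. ((\<Sum>j<s. B j \<omega>) / real s)\<^sup>2)
      = expectation (\<lambda>\<omega>. \<Sum>j<s. \<Sum>k<s. B j \<omega> * B k \<omega>) / (real s)\<^sup>2"
    by (simp add: power_divide sum_product power2_eq_square)
  also have "expectation (\<lambda>\<omega>. \<Sum>j<s. \<Sum>k<s. B j \<omega> * B k \<omega>)
      = (\<Sum>j<s. expectation (\<lambda>\<omega>. \<Sum>k<s. B j \<omega> * B k \<omega>))"
    using int2 by (intro Bochner_Integration.integral_sum Bochner_Integration.integrable_sum) auto
  also have "\<dots> = (\<Sum>j<s. \<Sum>k<s. expectation (\<lambda>\<omega>. B j \<omega> * B k \<omega>))"
    using int2 by (intro sum.cong Bochner_Integration.integral_sum) auto
  also have "\<dots> = (\<Sum>j<s. \<Sum>k<s. if j = k then p else p\<^sup>2)"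
    by (intro sum.cong cov) auto
  \<comment> \<open>A constant plus a correction supported on the diagonal: the inner sum then
    collapses to a single correction term.\<close>
  also have "\<dots> = (\<Sum>j<s. \<Sum>k<s. p\<^sup>2 + (if j = k then p - p\<^sup>2 else 0))"
    by (intro sum.cong) auto
  also have "\<dots> = (real s)\<^sup>2 * p\<^sup>2 + real s * (p - p\<^sup>2)"
    by (simp add: sum.distrib power2_eq_square algebra_simps)
  also have "\<dots> / (real s)\<^sup>2 = p * (1 / real s + (1 - 1 / real s) * p)"
    using s by (simp add: field_simps power2_eq_square)
  finally show "expectation (\<lambda>\<omega>. ((\<Sum>j<s. B j \<omega>) / real s)\<^sup>2)
      = p * (1 / real s + (1 - 1 / real s) * p)" .
qed

text \<open>The estimator is the mean of the 0-1 indicators that the terminals are connected in each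
  sample, so the Bernoulli moments apply with \<open>p\<close> the reliability.\<close>

lemma
  assumes "mc_samples M G s X" and "s > 0"
  shows expectation_mc_estimator: "expectation (mc_estimator G T s X) = reliability G T"
    and expectation_mc_estimator_square: "expectation (\<lambda>\<omega>. (mc_estimator G T s X \<omega>)\<^sup>2)
      = reliability G T * (1 / real s + (1 - 1 / real s) * reliability G T)"
    and random_variable_mc_estimator: "random_variable borel (mc_estimator G T s X)"
proof -
  define B where "B = (\<lambda>j \<omega>. of_bool (terminals_connected G T (X j \<omega>)) :: real)"
  have est: "mc_estimator G T s X = (\<lambda>\<omega>. (\<Sum>j<s. B j \<omega>) / real s)"
    by (auto simp: mc_estimator_def B_def Int_def intro!: ext arg_cong[where f = card])
  have indep: "indep_vars (\<lambda>_. borel) B {..<s}"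
    unfolding B_def
    \<comment> \<open>Every function on a discrete space is measurable, so independence passes from
      the samples to their indicators.\<close>
    by (rule indep_vars_compose2[where M' = "\<lambda>_. count_space UNIV"])
      (use assms in \<open>auto simp: mc_samples_def\<close>)
  have rvX: "random_variable (count_space UNIV) (X j)" if "j < s" for j
    using assms that by (auto simp: mc_samples_def indep_vars_def)
  have mean: "expectation (B j) = reliability G T" if "j < s" for j
  proof -
    have "expectation (B j)
        = integral\<^sup>L (distr M (count_space UNIV) (X j)) (indicator {F. terminals_connected G T F})"
      using rvX[OF that] by (subst integral_distr) (auto simp: B_def indicator_def)
    also have "\<dots> = reliability G T"
      using assms that by (simp add: mc_samples_def reliability_def)
    finally show ?thesis .
  qed
  have B01: "B j \<omega> \<in> {0, 1}" for j \<omega>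
    by (simp add: B_def)
  show "expectation (mc_estimator G T s X) = reliability G T"
    and "expectation (\<lambda>\<omega>. (mc_estimator G T s X \<omega>)\<^sup>2)
      = reliability G T * (1 / real s + (1 - 1 / real s) * reliability G T)"
    unfolding est using bernoulli_mean_moments[OF indep B01 mean assms(2)] by simp_all
  show "random_variable borel (mc_estimator G T s X)"
    using indep unfolding est
    by (intro borel_measurable_divide borel_measurable_sum) (auto simp: indep_vars_def)
qed

text \<open>The estimator is measurable with values between 0 and 1, hence so are its powers.
  Exponents 1 and 2 serve the variance computations.\<close>

lemma integrable_mc_estimator_power:
  assumes "mc_samples M G s X" and "s > 0"
  shows "integrable M (\<lambda>\<omega>. (mc_estimator G T s X \<omega>) ^ n)"
proof (rule integrable_const_bound[where B = 1])
  have "mc_estimator G T s X \<omega> \<le> 1" for \<omega>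
    using card_mono[of "{..<s}" "{j. j < s \<and> terminals_connected G T (X j \<omega>)}"] assms(2)
    by (auto simp: mc_estimator_def)
  then show "AE \<omega> in M. norm (mc_estimator G T s X \<omega> ^ n) \<le> 1"
    by (auto simp: mc_estimator_def power_abs intro!: power_le_one)
qed (use random_variable_mc_estimator[OF assms] in measurable)

text \<open>This evaluates the direct estimator, to which the product estimator is finally
  compared.\<close>

lemma variance_mc_estimator:
  assumes "mc_samples M G s X" and "s > 0"
  shows "variance (mc_estimator G T s X) = reliability G T * (1 - reliability G T) / real s"
proof -
  have "variance (mc_estimator G T s X)
      = reliability G T * (1 / real s + (1 - 1 / real s) * reliability G T) - (reliability G T)\<^sup>2"
    using integrable_mc_estimator_power[OF assms, of T 1] integrable_mc_estimator_power[OF assms, of T 2]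
    by (subst variance_eq)
      (simp_all add: expectation_mc_estimator[OF assms] expectation_mc_estimator_square[OF assms])
  also have "\<dots> = reliability G T * (1 - reliability G T) / real s"
    using assms(2) by (simp add: field_simps power2_eq_square)
  finally show ?thesis .
qed

text \<open>Squaring preserves independence, so the first and second moments of the product both
  factorize.\<close>

lemma variance_prod_indep:
  fixes Z :: "'i \<Rightarrow> 'a \<Rightarrow> real"
  assumes "finite I" and indep: "indep_vars (\<lambda>_. borel) Z I"
    and int: "\<And>i. i \<in> I \<Longrightarrow> integrable M (Z i)"
    and int2: "\<And>i. i \<in> I \<Longrightarrow> integrable M (\<lambda>\<omega>. (Z i \<omega>)\<^sup>2)"
  shows "variance (\<lambda>\<omega>. \<Prod>i\<in>I. Z i \<omega>)
    = (\<Prod>i\<in>I. expectation (\<lambda>\<omega>. (Z i \<omega>)\<^sup>2)) - (\<Prod>i\<in>I. expectation (Z i))\<^sup>2"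
proof -
  have indep2: "indep_vars (\<lambda>_. borel) (\<lambda>i \<omega>. (Z i \<omega>)\<^sup>2) I"
    by (rule indep_vars_compose2[OF indep]) simp
  have "integrable M (\<lambda>\<omega>. \<Prod>i\<in>I. Z i \<omega>)"
    by (rule indep_vars_integrable[OF assms(1) indep int])
  moreover have "integrable M (\<lambda>\<omega>. (\<Prod>i\<in>I. Z i \<omega>)\<^sup>2)"
    using indep_vars_integrable[OF assms(1) indep2 int2] by (simp add: prod_power_distrib)
  ultimately show ?thesis
    using indep_vars_lebesgue_integral[OF assms(1) indep int]
      indep_vars_lebesgue_integral[OF assms(1) indep2 int2]
    by (subst variance_eq) (simp_all add: prod_power_distrib)
qed

end

theorem theorem4:
  fixes G :: "'a uncertain_graph" and T :: "'a set"
    and Gs :: "nat \<Rightarrow> 'b uncertain_graph" and Ts :: "nat \<Rightarrow> 'b set"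
    and m s :: nat and p\<^sub>b :: real
    and M :: "'w measure" and X :: "nat \<Rightarrow> nat \<Rightarrow> 'w \<Rightarrow> 'b set set"
    and N :: "'u measure"
  assumes "uncertain_graph G" and "T \<subseteq> verts G"
    and "\<And>i. i \<in> {1..m} \<Longrightarrow> uncertain_graph (Gs i)"
    and "\<And>i. i \<in> {1..m} \<Longrightarrow> Ts i \<subseteq> verts (Gs i)"
    and "reliability G T = p\<^sub>b * (\<Prod>i\<in>{1..m}. reliability (Gs i) (Ts i))"
    and "s > 0"
    and "prob_space M"
    and "\<And>i. i \<in> {1..m} \<Longrightarrow> mc_samples M (Gs i) s (X i)"
    and "prob_space.indep_vars M (\<lambda>_. borel)
           (\<lambda>i. mc_estimator (Gs i) (Ts i) s (X i)) {1..m}"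
    and "0 < reliability G T" and "reliability G T < 1"
    and "0 < p\<^sub>b" and "p\<^sub>b < 1"
  shows "prob_space.variance M (\<lambda>\<omega>. p\<^sub>b * (\<Prod>i\<in>{1..m}. mc_estimator (Gs i) (Ts i) s (X i) \<omega>))
           < reliability G T * (1 - reliability G T) / real s
    \<and> (\<forall>Y. prob_space N \<and> mc_samples N G s Y \<longrightarrow>
           prob_space.variance M (\<lambda>\<omega>. p\<^sub>b * (\<Prod>i\<in>{1..m}. mc_estimator (Gs i) (Ts i) s (X i) \<omega>))
             < prob_space.variance N (mc_estimator G T s Y))"
proof -
  interpret prob_space M by fact
  let ?Z = "\<lambda>i. mc_estimator (Gs i) (Ts i) s (X i)"
  define x where "x i = reliability (Gs i) (Ts i)" for i
  define P where "P = (\<Prod>i\<in>{1..m}. x i)"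
  define R where "R = reliability G T"
  define r where "r = 1 / real s"
  have r: "0 < r" "r \<le> 1"
    using \<open>s > 0\<close> by (auto simp: r_def)
  have x01: "0 \<le> x i \<and> x i \<le> 1" for i
    by (simp add: x_def reliability_def)
  have R: "R = p\<^sub>b * P" "0 < R"
    using assms(5,10) by (simp_all add: R_def P_def x_def)
  have P: "0 \<le> P"
    using x01 by (auto simp: P_def intro: prod_nonneg)
  note mc = assms(8) \<open>s > 0\<close>
  have "variance (\<lambda>\<omega>. p\<^sub>b * (\<Prod>i\<in>{1..m}. ?Z i \<omega>)) = p\<^sub>b\<^sup>2 * variance (\<lambda>\<omega>. \<Prod>i\<in>{1..m}. ?Z i \<omega>)"
    by (simp add: right_diff_distrib[symmetric] power_mult_distrib)
  also have "variance (\<lambda>\<omega>. \<Prod>i\<in>{1..m}. ?Z i \<omega>) = (\<Prod>i\<in>{1..m}. x i * (r + (1 - r) * x i)) - P\<^sup>2"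
    using integrable_mc_estimator_power[OF mc, where n = 1]
      integrable_mc_estimator_power[OF mc, where n = 2]
    by (subst variance_prod_indep[OF _ assms(9)])
      (simp_all add: expectation_mc_estimator[OF mc] expectation_mc_estimator_square[OF mc]
        x_def P_def r_def)
  \<comment> \<open>The product of second moments splits into \<open>P\<close> times a product of
    affine images, which \<open>prod_affine_le\<close> bounds by the affine image of
    \<open>P\<close>.\<close>
  also have "p\<^sub>b\<^sup>2 * \<dots> \<le> p\<^sub>b\<^sup>2 * (P * (r + (1 - r) * P) - P\<^sup>2)"
    using prod_affine_le[of r "{1..m}" x] r x01 P
    by (auto simp: prod.distrib P_def intro!: mult_left_mono)
  \<comment> \<open>Substituting \<open>R = p\<^sub>b * P\<close> turns the square of the mean into
    \<open>R * R\<close>, which cancels all of \<open>(1 - r) * R * R\<close> and leaves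
    \<open>- r * R * R\<close>.\<close>
  also have "\<dots> = R * (r * p\<^sub>b - r * R)"
    by (simp add: R algebra_simps power2_eq_square)
  \<comment> \<open>The strict gain comes from replacing \<open>p\<^sub>b\<close> by 1, with
    \<open>r\<close> and \<open>R\<close> positive.\<close>
  also have "\<dots> < R * (r * 1 - r * R)"
    using R(2) r \<open>p\<^sub>b < 1\<close> by (intro mult_strict_left_mono) auto
  also have "\<dots> = R * (1 - R) / real s"
    by (simp add: r_def algebra_simps diff_divide_distrib)
  finally have main: "variance (\<lambda>\<omega>. p\<^sub>b * (\<Prod>i\<in>{1..m}. ?Z i \<omega>)) < R * (1 - R) / real s" .
  then show ?thesis
    using prob_space.variance_mc_estimator[of N G s _ T] \<open>s > 0\<close> by (auto simp: R_def)
qed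

end
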